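(* For any $\mathrm{SQCLP}(\mathcal{S},\mathcal{D},\mathcal{C})$-program $\mathcal{P}$, its least model is $\mathcal{M}_{\mathcal{P}}=\{\varphi \mid \varphi \text{ is an observable defined qc-atom and } \mathcal{P}\vdash_{\mathcal{S},\mathcal{D},\mathcal{C}}\varphi\}$.
   Context: Let $\langle \mathcal{S},\mathcal{D},\mathcal{C}\rangle$ be an admissible triple. $\mathcal{C}$ is a constraint domain whose carrier is the set of ground terms, with primitive predicates interpreted as boolean functions; $\mathcal{C}$-constraints are built from primitive atoms and equations $t == s$ by conjunction and existential quantification; $\Pi \models_{\mathcal{C}} \pi$ means every valuation (ground substitution) solving $\Pi$ solves $\pi$. $\mathcal{D}=\langle D,\trianglelefteq,\mathbf{b},\mathbf{t},\circ\rangle$ is a qualification domain: a lattice with bottom $\mathbf{b}$, top $\mathbf{t}$, greatest lower bound $\sqcap$, and attenuation operation $\circ$ (associative, commutative, monotonic, $d\circ\mathbf{t}=d$, $d\circ\mathbf{b}=\mathbf{b}$, $d\circ e\trianglelefteq e$ with $\mathbf{b}\neq d\circ e$ when $d,e\neq\mathbf{b}$, distributive over $\sqcap$), expressible in $\mathcal{C}$. $\mathcal{S}$ is a reflexive ($\mathcal{S}(x,x)=\mathbf{t}$), symmetric, not necessarily transitive $D$-valued proximity relation on variables, basic values, data constructors and predicate symbols (identity on variables; nonbottom only between identical symbols, between basic values, or between constructors, resp. defined predicates, of equal arity), extended to terms by $\mathcal{S}(t,t)=\mathbf{t}$, $\mathcal{S}(X,t)=\mathbf{b}$ for variable $X\neq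 t$, $\mathbf{b}$ for constructors of different arities, and $\mathcal{S}(c(t_1,\dots,t_n),c'(t'_1,\dots,t'_n))=\mathcal{S}(c,c')\sqcap\mathcal{S}(t_1,t'_1)\sqcap\dots\sqcap\mathcal{S}(t_n,t'_n)$. $t\approx_{\lambda,\Pi}s$ (for $\lambda\neq\mathbf{b}$) iff there are $\hat t,\hat s$ with $\Pi\models_{\mathcal{C}} t==\hat t$, $\Pi\models_{\mathcal{C}} s==\hat s$, $\mathcal{S}(\hat t,\hat s)\trianglerighteq\lambda$. A program $\mathcal{P}$ is a set of clauses $p(t_1,\dots,t_n)\leftarrow_{\alpha} B_1\#w_1,\dots,B_m\#w_m$ ($p$ defined predicate, $\alpha\in D\setminus\{\mathbf{b}\}$, $w_j\in(D\setminus\{\mathbf{b}\})\cup\{?\}$; $e\trianglerighteq^? w$ means $e\trianglerighteq w$ if $w\neq ?$, true otherwise). A qc-atom $(A\#d\Leftarrow\Pi)$ is defined, equational or primitive according to $A$, and observable iff $d\neq\mathbf{b}$ and $\Pi$ is satisfiable. $(A\#d\Leftarrow\Pi)$ entails $(A'\#d'\Leftarrow\Pi')$ iff for some substitution $\theta$, $A'=A\theta$, $d'\trianglelefteq d$, $\Pi'\models_{\mathcal{C}}\Pi\theta$. A qc-interpretation is a set of defined observable qc-atoms closed under entailment; $\mathcal{I}\Vdash\varphi$ iff $\varphi$ defined and in $\mathcal{I}$, or $\varphi=((t==s)\#d\Leftarrow\Pi)$ with $t\approx_{d,\Pi}s$, or $\varphi=(\kappa\#d\Leftarrow\Pi)$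 primitive with $\Pi\models_{\mathcal{C}}\kappa$. $(p'(t'_1,\dots,t'_n)\#d\Leftarrow\Pi)$ is an immediate consequence of $\mathcal{I}$ via clause $p(t_1,\dots,t_n)\leftarrow_{\alpha}B_1\#w_1,\dots,B_m\#w_m$ iff for some substitution $\theta$ and $d_0,\dots,d_n,e_1,\dots,e_m\in D\setminus\{\mathbf{b}\}$: $\mathcal{S}(p',p)=d_0$, $t'_i\approx_{d_i,\Pi}t_i\theta$, $\mathcal{I}\Vdash(B_j\theta\#e_j\Leftarrow\Pi)$ with $e_j\trianglerighteq^? w_j$, and $d\trianglelefteq d_0\sqcap d_1\sqcap\dots\sqcap d_n\sqcap(\alpha\circ(e_1\sqcap\dots\sqcap e_m))$ (empty glb $=\mathbf{t}$). $\mathcal{I}$ is a model of $\mathcal{P}$ iff it contains all its defined observable immediate consequences via clauses of $\mathcal{P}$; $\mathcal{M}_{\mathcal{P}}$ denotes the least model of $\mathcal{P}$ under set inclusion (which exists). $\mathcal{P}\vdash_{\mathcal{S},\mathcal{D},\mathcal{C}}\varphi$ means $\varphi$ is derivable in the logic $\mathrm{SQCHL}(\mathcal{S},\mathcal{D},\mathcal{C})$ with three rules: (SQDA) from premises $((t'_i==t_i\theta)\#d_i\Leftarrow\Pi)$ for $i=1..n$ and $(B_j\theta\#e_j\Leftarrow\Pi)$ for $j=1..m$ infer $(p'(t'_1,\dots,t'_n)\#d\Leftarrow\Pi)$, provided $p(t_1,\dots,t_n)\leftarrow_{\alpha}B_1\#w_1,\dots,B_m\#w_m\in\mathcal{P}$,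 $\theta$ a substitution, $\mathcal{S}(p',p)=d_0\neq\mathbf{b}$, $e_j\trianglerighteq^? w_j$ and $d\trianglelefteq d_0\sqcap d_1\sqcap\dots\sqcap d_n\sqcap(\alpha\circ(e_1\sqcap\dots\sqcap e_m))$; (SQEA) infer $((t==s)\#d\Leftarrow\Pi)$ if $t\approx_{d,\Pi}s$; (SQPA) infer $(\kappa\#d\Leftarrow\Pi)$ if $\Pi\models_{\mathcal{C}}\kappa$. *)

theory Defs
  imports Main "HOL-Library.Infinite_Typeclass"
begin

subsection \<open>Qualification domains\<close>

text \<open>The partial order of the lattice is \<open>\<le>\<close>, the extreme points are \<open>bot\<close> and \<open>top\<close>.\<close>

class qualification_domain = bounded_lattice +
  fixes attenuate :: "'a \<Rightarrow> 'a \<Rightarrow> 'a"  (infixl "\<odot>" 75)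
  assumes attenuate_assoc: "(d \<odot> e) \<odot> f = d \<odot> (e \<odot> f)"
    and attenuate_commute: "d \<odot> e = e \<odot> d"
    and attenuate_mono: "d \<le> d' \<Longrightarrow> e \<le> e' \<Longrightarrow> d \<odot> e \<le> d' \<odot> e'"
    and attenuate_top: "d \<odot> top = d"
    and attenuate_bot: "d \<odot> bot = bot"
    and attenuate_le: "d \<noteq> bot \<Longrightarrow> e \<noteq> bot \<Longrightarrow> d \<odot> e \<le> e"
    and attenuate_not_bot: "d \<noteq> bot \<Longrightarrow> e \<noteq> bot \<Longrightarrow> d \<odot> e \<noteq> bot"
    and attenuate_inf: "d \<odot> inf e1 e2 = inf (d \<odot> e1) (d \<odot> e2)"

definition glb :: "'d::bounded_lattice list \<Rightarrow> 'd" where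
  "glb ds = foldr inf ds top"

subsection \<open>Terms, substitutions and constraint domains\<close>

text \<open>
  Type variables: \<open>'v\<close> variables, \<open>'b\<close> basic values, \<open>'c\<close> data constructors, \<open>'p\<close> defined
  predicate symbols, \<open>'k\<close> primitive predicate symbols, \<open>'d\<close> qualification values. The raw
  syntax ignores arities; these are given by the signature part of a constraint domain and
  are enforced by the well-formedness predicates below.
\<close>

datatype (tvars: 'v, 'b, 'c) trm =
  Var 'v | Val 'b | Con 'c "('v, 'b, 'c) trm list"

type_synonym ('v, 'b, 'c) subst = "'v \<Rightarrow> ('v, 'b, 'c) trm"

primrec tsubst :: "('v, 'b, 'c) subst \<Rightarrow> ('v, 'b, 'c) trm \<Rightarrow> ('v, 'b, 'c) trm" where
  "tsubst \<theta> (Var x) = \<theta> x"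
| "tsubst \<theta> (Val u) = Val u"
| "tsubst \<theta> (Con c ts) = Con c (map (tsubst \<theta>) ts)"

text \<open>
  Only the values of \<open>prim_interp\<close> on lists of ground terms of the right length matter.
\<close>

record ('v, 'b, 'c, 'p, 'k) constraint_domain =
  con_arity :: "'c \<Rightarrow> nat"
  def_arity :: "'p \<Rightarrow> nat"
  prim_arity :: "'k \<Rightarrow> nat"
  prim_interp :: "'k \<Rightarrow> ('v, 'b, 'c) trm list \<Rightarrow> bool"

fun wf_trm :: "('v, 'b, 'c, 'p, 'k) constraint_domain \<Rightarrow> ('v, 'b, 'c) trm \<Rightarrow> bool" where
  "wf_trm C (Var x) = True"
| "wf_trm C (Val u) = True"
| "wf_trm C (Con c ts) = (length ts = con_arity C c \<and> (\<forall>t\<in>set ts. wf_trm C t))"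

definition wf_subst :: "('v, 'b, 'c, 'p, 'k) constraint_domain \<Rightarrow> ('v, 'b, 'c) subst \<Rightarrow> bool" where
  "wf_subst C \<theta> \<longleftrightarrow> (\<forall>x. wf_trm C (\<theta> x))"

definition carrier :: "('v, 'b, 'c, 'p, 'k) constraint_domain \<Rightarrow> ('v, 'b, 'c) trm set" where
  "carrier C = {t. wf_trm C t \<and> tvars t = {}}"

definition valuations :: "('v, 'b, 'c, 'p, 'k) constraint_domain \<Rightarrow> ('v, 'b, 'c) subst set" where
  "valuations C = {\<eta>. \<forall>x. \<eta> x \<in> carrier C}"

subsection \<open>Constraints\<close>

datatype ('v, 'b, 'c, 'k) constr =
    CPrim 'k "('v, 'b, 'c) trm list"
  | CEq "('v, 'b, 'c) trm" "('v, 'b, 'c) trm"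
  | CAnd "('v, 'b, 'c, 'k) constr" "('v, 'b, 'c, 'k) constr"
  | CEx 'v "('v, 'b, 'c, 'k) constr"

primrec wf_constr :: "('v, 'b, 'c, 'p, 'k) constraint_domain \<Rightarrow> ('v, 'b, 'c, 'k) constr \<Rightarrow> bool" where
  "wf_constr C (CPrim k ts) = (length ts = prim_arity C k \<and> (\<forall>t\<in>set ts. wf_trm C t))"
| "wf_constr C (CEq t s) = (wf_trm C t \<and> wf_trm C s)"
| "wf_constr C (CAnd \<pi> \<pi>') = (wf_constr C \<pi> \<and> wf_constr C \<pi>')"
| "wf_constr C (CEx x \<pi>) = wf_constr C \<pi>"

primrec fv :: "('v, 'b, 'c, 'k) constr \<Rightarrow> 'v set" where
  "fv (CPrim k ts) = (\<Union>t\<in>set ts. tvars t)"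
| "fv (CEq t s) = tvars t \<union> tvars s"
| "fv (CAnd \<pi> \<pi>') = fv \<pi> \<union> fv \<pi>'"
| "fv (CEx x \<pi>) = fv \<pi> - {x}"

text \<open>
  Capture-avoiding substitution: the bound variable is renamed to one outside \<open>V\<close> exactly when
  it occurs in the image of some other free variable.
\<close>

primrec csubst :: "('v::infinite, 'b, 'c) subst \<Rightarrow> ('v, 'b, 'c, 'k) constr \<Rightarrow> ('v, 'b, 'c, 'k) constr" where
  "csubst \<theta> (CPrim k ts) = CPrim k (map (tsubst \<theta>) ts)"
| "csubst \<theta> (CEq t s) = CEq (tsubst \<theta> t) (tsubst \<theta> s)"
| "csubst \<theta> (CAnd \<pi> \<pi>') = CAnd (csubst \<theta> \<pi>) (csubst \<theta> \<pi>')"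
| "csubst \<theta> (CEx x \<pi>) =
     (let V = (\<Union>z \<in> fv \<pi> - {x}. tvars (\<theta> z));
          y = (if x \<in> V then SOME y. y \<notin> V else x)
      in CEx y (csubst (\<theta>(x := Var y)) \<pi>))"

primrec solves :: "('v, 'b, 'c, 'p, 'k) constraint_domain \<Rightarrow> ('v, 'b, 'c, 'k) constr \<Rightarrow> ('v, 'b, 'c) subst \<Rightarrow> bool" where
  "solves C (CPrim k ts) \<eta> = prim_interp C k (map (tsubst \<eta>) ts)"
| "solves C (CEq t s) \<eta> = (tsubst \<eta> t = tsubst \<eta> s)"
| "solves C (CAnd \<pi> \<pi>') \<eta> = (solves C \<pi> \<eta> \<and> solves C \<pi>' \<eta>)"
| "solves C (CEx x \<pi>) \<eta> = (\<exists>t\<in>carrier C. solves C \<pi> (\<eta>(x := t)))"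

definition Sol :: "('v, 'b, 'c, 'p, 'k) constraint_domain \<Rightarrow> ('v, 'b, 'c, 'k) constr set \<Rightarrow> ('v, 'b, 'c) subst set" where
  "Sol C \<Pi> = {\<eta> \<in> valuations C. \<forall>\<pi>\<in>\<Pi>. solves C \<pi> \<eta>}"

definition satisfiable :: "('v, 'b, 'c, 'p, 'k) constraint_domain \<Rightarrow> ('v, 'b, 'c, 'k) constr set \<Rightarrow> bool" where
  "satisfiable C \<Pi> \<longleftrightarrow> Sol C \<Pi> \<noteq> {}"

definition centails :: "('v, 'b, 'c, 'p, 'k) constraint_domain \<Rightarrow> ('v, 'b, 'c, 'k) constr set \<Rightarrow> ('v, 'b, 'c, 'k) constr \<Rightarrow> bool" where
  "centails C \<Pi> \<pi> \<longleftrightarrow> Sol C \<Pi> \<subseteq> Sol C {\<pi>}"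

subsection \<open>Admissible triples\<close>

text \<open>
  Expressibility of the qualification domain \<open>'d\<close> in \<open>C\<close>: the nonbottom values embed injectively
  into the carrier, one constraint \<open>qVal(X)\<close> defines the image, and one constraint
  \<open>qBound(X, Y, Z)\<close> encodes \<open>x \<le> y \<odot> z\<close>.
\<close>

definition expressible_via ::
  "('v, 'b, 'c, 'p, 'k) constraint_domain \<Rightarrow> ('d::qualification_domain \<Rightarrow> ('v, 'b, 'c) trm) \<Rightarrow> bool" where
  "expressible_via C \<iota> \<longleftrightarrow>
     inj_on \<iota> (- {bot}) \<and> \<iota> ` (- {bot}) \<subseteq> carrier C \<and>
     (\<exists>X qVal. wf_constr C qVal \<and> fv qVal \<subseteq> {X} \<and>
        (\<forall>\<eta>\<in>valuations C. \<eta> \<in> Sol C {qVal} \<longleftrightarrow> \<eta> X \<in> \<iota> ` (- {bot}))) \<and>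
     (\<exists>X Y Z qBound. distinct [X, Y, Z] \<and> wf_constr C qBound \<and> fv qBound \<subseteq> {X, Y, Z} \<and>
        (\<forall>x y z. x \<noteq> bot \<and> y \<noteq> bot \<and> z \<noteq> bot \<longrightarrow>
          (\<forall>\<eta>\<in>valuations C. \<eta> X = \<iota> x \<and> \<eta> Y = \<iota> y \<and> \<eta> Z = \<iota> z \<longrightarrow>
             (\<eta> \<in> Sol C {qBound} \<longleftrightarrow> x \<le> y \<odot> z))))"

datatype ('v, 'b, 'c, 'p, 'k) sym =
  SVar 'v | SVal 'b | SCon 'c | SDef 'p | SPrim 'k

type_synonym ('v, 'b, 'c, 'p, 'k, 'd) proximity =
  "('v, 'b, 'c, 'p, 'k) sym \<Rightarrow> ('v, 'b, 'c, 'p, 'k) sym \<Rightarrow> 'd"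

definition admissible_proximity ::
  "('v, 'b, 'c, 'p, 'k) constraint_domain \<Rightarrow> ('v, 'b, 'c, 'p, 'k, 'd::bounded_lattice) proximity \<Rightarrow> bool" where
  "admissible_proximity C S \<longleftrightarrow>
     (\<forall>x. S x x = top) \<and>
     (\<forall>x y. S x y = S y x) \<and>
     (\<forall>X Y. X \<noteq> Y \<longrightarrow> S (SVar X) (SVar Y) = bot) \<and>
     (\<forall>x y. S x y \<noteq> bot \<longrightarrow>
        x = y \<or>
        (\<exists>u u'. x = SVal u \<and> y = SVal u') \<or>
        (\<exists>c c'. x = SCon c \<and> y = SCon c' \<and> con_arity C c = con_arity C c') \<or>
        (\<exists>p p'. x = SDef p \<and> y = SDef p' \<and> def_arity C p = def_arity C p'))"

definition admissible_triple ::
  "('v, 'b, 'c, 'p, 'k) constraint_domain \<Rightarrow> ('v, 'b, 'c, 'p, 'k, 'd::qualification_domain) proximity \<Rightarrow> bool" where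
  "admissible_triple C S \<longleftrightarrow>
     admissible_proximity C S \<and>
     (\<exists>\<iota> :: 'd \<Rightarrow> ('v, 'b, 'c) trm. expressible_via C \<iota>)"

lemma zip_size_less [termination_simp]:
  assumes "(t, t') \<in> set (zip ts ts')"
  shows "size t < Suc (size_list size ts)" and "size t' < Suc (size_list size ts')"
  using assms by (meson less_Suc_eq_le set_zip_leftD set_zip_rightD size_list_estimation' order_refl)+

text \<open>Basic values behave like nullary symbols; they are never close to constructor terms.\<close>

fun prox :: "('v, 'b, 'c, 'p, 'k, 'd::bounded_lattice) proximity \<Rightarrow> ('v, 'b, 'c) trm \<Rightarrow> ('v, 'b, 'c) trm \<Rightarrow> 'd" where
  "prox S (Var X) t = (if t = Var X then top else bot)"
| "prox S t (Var X) = (if t = Var X then top else bot)"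
| "prox S (Val u) (Val u') = S (SVal u) (SVal u')"
| "prox S (Con c ts) (Con c' ts') =
     (if length ts = length ts'
      then inf (S (SCon c) (SCon c')) (glb (map (\<lambda>(t, t'). prox S t t') (zip ts ts')))
      else bot)"
| "prox S _ _ = bot"

lemma prox_refl:
  assumes "\<And>x. S x x = top"
  shows "prox S t t = top"
proof (induction t)
  case (Con c ts)
  have "\<forall>t\<in>set us. prox S t t = top \<Longrightarrow> glb (map (\<lambda>(t, t'). prox S t t') (zip us us)) = top" for us
    by (induction us) (auto simp: glb_def)
  then show ?case using Con assms by simp
qed (auto simp: assms)

definition near ::
  "('v, 'b, 'c, 'p, 'k) constraint_domain \<Rightarrow> ('v, 'b, 'c, 'p, 'k, 'd::bounded_lattice) proximity \<Rightarrow>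
   'd \<Rightarrow> ('v, 'b, 'c, 'k) constr set \<Rightarrow> ('v, 'b, 'c) trm \<Rightarrow> ('v, 'b, 'c) trm \<Rightarrow> bool" where
  "near C S d \<Pi> t s \<longleftrightarrow> d \<noteq> bot \<and>
     (\<exists>t' s'. wf_trm C t' \<and> wf_trm C s' \<and>
        centails C \<Pi> (CEq t t') \<and> centails C \<Pi> (CEq s s') \<and> d \<le> prox S t' s')"

subsection \<open>Programs and qc-atoms\<close>

datatype ('v, 'b, 'c, 'p, 'k) atm =
    Defined 'p "('v, 'b, 'c) trm list"
  | Eqn "('v, 'b, 'c) trm" "('v, 'b, 'c) trm"
  | Prim 'k "('v, 'b, 'c) trm list"

primrec wf_atm :: "('v, 'b, 'c, 'p, 'k) constraint_domain \<Rightarrow> ('v, 'b, 'c, 'p, 'k) atm \<Rightarrow> bool" where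
  "wf_atm C (Defined p ts) = (length ts = def_arity C p \<and> (\<forall>t\<in>set ts. wf_trm C t))"
| "wf_atm C (Eqn t s) = (wf_trm C t \<and> wf_trm C s)"
| "wf_atm C (Prim k ts) = (length ts = prim_arity C k \<and> (\<forall>t\<in>set ts. wf_trm C t))"

primrec asubst :: "('v, 'b, 'c) subst \<Rightarrow> ('v, 'b, 'c, 'p, 'k) atm \<Rightarrow> ('v, 'b, 'c, 'p, 'k) atm" where
  "asubst \<theta> (Defined p ts) = Defined p (map (tsubst \<theta>) ts)"
| "asubst \<theta> (Eqn t s) = Eqn (tsubst \<theta> t) (tsubst \<theta> s)"
| "asubst \<theta> (Prim k ts) = Prim k (map (tsubst \<theta>) ts)"

text \<open>
  \<open>Clause p ts \<alpha> Bs\<close> has head \<open>p(ts)\<close>, attenuation factor \<open>\<alpha>\<close> and body \<open>Bs\<close>; the threshold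
  \<open>?\<close> of a body atom is \<open>None\<close>.
\<close>

datatype ('v, 'b, 'c, 'p, 'k, 'd) clause =
  Clause 'p "('v, 'b, 'c) trm list" 'd "(('v, 'b, 'c, 'p, 'k) atm \<times> 'd option) list"

fun meets_threshold :: "'d::bounded_lattice \<Rightarrow> 'd option \<Rightarrow> bool" where
  "meets_threshold e None = True"
| "meets_threshold e (Some w) = (w \<le> e)"

fun wf_clause :: "('v, 'b, 'c, 'p, 'k) constraint_domain \<Rightarrow> ('v, 'b, 'c, 'p, 'k, 'd::bounded_lattice) clause \<Rightarrow> bool" where
  "wf_clause C (Clause p ts \<alpha> Bs) \<longleftrightarrow>
     wf_atm C (Defined p ts) \<and> \<alpha> \<noteq> bot \<and>
     (\<forall>(B, w) \<in> set Bs. wf_atm C B \<and> w \<noteq> Some bot)"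

definition is_program ::
  "('v, 'b, 'c, 'p, 'k) constraint_domain \<Rightarrow> ('v, 'b, 'c, 'p, 'k, 'd::bounded_lattice) clause set \<Rightarrow> bool" where
  "is_program C P \<longleftrightarrow> (\<forall>cl\<in>P. wf_clause C cl)"

text \<open>\<open>QC A d \<Pi>\<close> is the qc-atom \<open>A # d \<Leftarrow> \<Pi>\<close>.\<close>

datatype ('v, 'b, 'c, 'p, 'k, 'd) qcatom =
  QC "('v, 'b, 'c, 'p, 'k) atm" 'd "('v, 'b, 'c, 'k) constr set"

fun wf_qcatom :: "('v, 'b, 'c, 'p, 'k) constraint_domain \<Rightarrow> ('v, 'b, 'c, 'p, 'k, 'd) qcatom \<Rightarrow> bool" where
  "wf_qcatom C (QC A d \<Pi>) \<longleftrightarrow> wf_atm C A \<and> (\<forall>\<pi>\<in>\<Pi>. wf_constr C \<pi>)"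

fun is_defined :: "('v, 'b, 'c, 'p, 'k, 'd) qcatom \<Rightarrow> bool" where
  "is_defined (QC A d \<Pi>) \<longleftrightarrow> (\<exists>p ts. A = Defined p ts)"

fun observable :: "('v, 'b, 'c, 'p, 'k) constraint_domain \<Rightarrow> ('v, 'b, 'c, 'p, 'k, 'd::bounded_lattice) qcatom \<Rightarrow> bool" where
  "observable C (QC A d \<Pi>) \<longleftrightarrow> d \<noteq> bot \<and> satisfiable C \<Pi>"

fun qc_entails ::
  "('v::infinite, 'b, 'c, 'p, 'k) constraint_domain \<Rightarrow>
   ('v, 'b, 'c, 'p, 'k, 'd::bounded_lattice) qcatom \<Rightarrow> ('v, 'b, 'c, 'p, 'k, 'd) qcatom \<Rightarrow> bool" where
  "qc_entails C (QC A d \<Pi>) (QC A' d' \<Pi>') \<longleftrightarrow>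
     (\<exists>\<theta>. wf_subst C \<theta> \<and> A' = asubst \<theta> A \<and> d' \<le> d \<and> (\<forall>\<pi>\<in>\<Pi>. centails C \<Pi>' (csubst \<theta> \<pi>)))"

subsection \<open>Declarative semantics\<close>

text \<open>Closure under entailment is relative to the observable qc-atoms.\<close>

definition qc_interpretation ::
  "('v::infinite, 'b, 'c, 'p, 'k) constraint_domain \<Rightarrow> ('v, 'b, 'c, 'p, 'k, 'd::bounded_lattice) qcatom set \<Rightarrow> bool" where
  "qc_interpretation C I \<longleftrightarrow>
     I \<subseteq> {\<phi>. wf_qcatom C \<phi> \<and> is_defined \<phi> \<and> observable C \<phi>} \<and>
     (\<forall>\<phi>\<in>I. \<forall>\<phi>'. wf_qcatom C \<phi>' \<and> observable C \<phi>' \<and> qc_entails C \<phi> \<phi>' \<longrightarrow> \<phi>' \<in> I)"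

fun holds ::
  "('v, 'b, 'c, 'p, 'k) constraint_domain \<Rightarrow> ('v, 'b, 'c, 'p, 'k, 'd::bounded_lattice) proximity \<Rightarrow>
   ('v, 'b, 'c, 'p, 'k, 'd) qcatom set \<Rightarrow> ('v, 'b, 'c, 'p, 'k, 'd) qcatom \<Rightarrow> bool" where
  "holds C S I (QC (Defined p ts) d \<Pi>) \<longleftrightarrow> QC (Defined p ts) d \<Pi> \<in> I"
| "holds C S I (QC (Eqn t s) d \<Pi>) \<longleftrightarrow> near C S d \<Pi> t s"
| "holds C S I (QC (Prim k ts) d \<Pi>) \<longleftrightarrow> centails C \<Pi> (CPrim k ts)"

fun immediate_consequence ::
  "('v, 'b, 'c, 'p, 'k) constraint_domain \<Rightarrow> ('v, 'b, 'c, 'p, 'k, 'd::qualification_domain) proximity \<Rightarrow>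
   ('v, 'b, 'c, 'p, 'k, 'd) qcatom set \<Rightarrow> ('v, 'b, 'c, 'p, 'k, 'd) clause \<Rightarrow>
   ('v, 'b, 'c, 'p, 'k, 'd) qcatom \<Rightarrow> bool" where
  "immediate_consequence C S I (Clause p ts \<alpha> Bs) (QC A d \<Pi>) \<longleftrightarrow>
     (\<exists>p' ts' \<theta> d0 ds es.
        A = Defined p' ts' \<and> wf_subst C \<theta> \<and>
        length ts' = length ts \<and> length ds = length ts \<and> length es = length Bs \<and>
        d0 \<noteq> bot \<and> bot \<notin> set ds \<and> bot \<notin> set es \<and>
        S (SDef p') (SDef p) = d0 \<and>
        (\<forall>i<length ts. near C S (ds ! i) \<Pi> (ts' ! i) (tsubst \<theta> (ts ! i))) \<and>
        (\<forall>j<length Bs. holds C S I (QC (asubst \<theta> (fst (Bs ! j))) (es ! j) \<Pi>) \<and>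
                       meets_threshold (es ! j) (snd (Bs ! j))) \<and>
        d \<le> inf (inf d0 (glb ds)) (\<alpha> \<odot> glb es))"

definition is_model ::
  "('v::infinite, 'b, 'c, 'p, 'k) constraint_domain \<Rightarrow> ('v, 'b, 'c, 'p, 'k, 'd::qualification_domain) proximity \<Rightarrow>
   ('v, 'b, 'c, 'p, 'k, 'd) clause set \<Rightarrow> ('v, 'b, 'c, 'p, 'k, 'd) qcatom set \<Rightarrow> bool" where
  "is_model C S P I \<longleftrightarrow> qc_interpretation C I \<and>
     (\<forall>cl\<in>P. \<forall>\<phi>. wf_qcatom C \<phi> \<and> is_defined \<phi> \<and> observable C \<phi> \<and>
        immediate_consequence C S I cl \<phi> \<longrightarrow> \<phi> \<in> I)"

definition least_model ::
  "('v::infinite, 'b, 'c, 'p, 'k) constraint_domain \<Rightarrow> ('v, 'b, 'c, 'p, 'k, 'd::qualification_domain) proximity \<Rightarrow>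
   ('v, 'b, 'c, 'p, 'k, 'd) clause set \<Rightarrow> ('v, 'b, 'c, 'p, 'k, 'd) qcatom set" where
  "least_model C S P = (LEAST I. is_model C S P I)"

subsection \<open>The logic SQCHL\<close>

inductive derivable ::
  "('v, 'b, 'c, 'p, 'k) constraint_domain \<Rightarrow> ('v, 'b, 'c, 'p, 'k, 'd::qualification_domain) proximity \<Rightarrow>
   ('v, 'b, 'c, 'p, 'k, 'd) clause set \<Rightarrow> ('v, 'b, 'c, 'p, 'k, 'd) qcatom \<Rightarrow> bool"
  for C S P where
  SQDA: "\<lbrakk> wf_qcatom C (QC (Defined p' ts') d \<Pi>);
           Clause p ts \<alpha> Bs \<in> P; wf_subst C \<theta>;
           length ts' = length ts; length ds = length ts; length es = length Bs;
           S (SDef p') (SDef p) = d0; d0 \<noteq> bot;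
           \<And>i. i < length ts \<Longrightarrow> derivable C S P (QC (Eqn (ts' ! i) (tsubst \<theta> (ts ! i))) (ds ! i) \<Pi>);
           \<And>j. j < length Bs \<Longrightarrow> derivable C S P (QC (asubst \<theta> (fst (Bs ! j))) (es ! j) \<Pi>);
           \<And>j. j < length Bs \<Longrightarrow> meets_threshold (es ! j) (snd (Bs ! j));
           d \<le> inf (inf d0 (glb ds)) (\<alpha> \<odot> glb es) \<rbrakk>
         \<Longrightarrow> derivable C S P (QC (Defined p' ts') d \<Pi>)"
| SQEA: "\<lbrakk> wf_qcatom C (QC (Eqn t s) d \<Pi>); near C S d \<Pi> t s \<rbrakk>
         \<Longrightarrow> derivable C S P (QC (Eqn t s) d \<Pi>)"
| SQPA: "\<lbrakk> wf_qcatom C (QC (Prim k ts) d \<Pi>); centails C \<Pi> (CPrim k ts) \<rbrakk>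
         \<Longrightarrow> derivable C S P (QC (Prim k ts) d \<Pi>)"

subsection \<open>Existence of the least model\<close>

lemma holds_mono: "holds C S I \<phi> \<Longrightarrow> I \<subseteq> J \<Longrightarrow> holds C S J \<phi>"
  by (cases "(C, S, I, \<phi>)" rule: holds.cases) auto

lemma immediate_consequence_mono:
  assumes "immediate_consequence C S I cl \<phi>" "I \<subseteq> J"
  shows "immediate_consequence C S J cl \<phi>"
proof (cases cl; cases \<phi>)
  fix p ts \<alpha> Bs A d \<Pi>
  assume "cl = Clause p ts \<alpha> Bs" "\<phi> = QC A d \<Pi>"
  then show ?thesis
    using assms(1) holds_mono[OF _ assms(2)]
    by (simp only: immediate_consequence.simps) (elim ex_forward conj_forward; blast)
qed

lemma is_model_Inter: "is_model C S P (\<Inter>{I. is_model C S P I})"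
proof -
  let ?U = "{\<phi>. wf_qcatom C \<phi> \<and> is_defined \<phi> \<and> observable C \<phi>}"
  have def_entails: "is_defined \<phi>'" if "is_defined \<phi>" "qc_entails C \<phi> \<phi>'" for \<phi> \<phi>' :: "('a, 'b, 'c, 'd, 'e, 'f) qcatom"
    using that by (cases \<phi>; cases \<phi>') auto
  have "is_model C S P ?U"
    unfolding is_model_def qc_interpretation_def using def_entails by blast
  then have "\<Inter>{I. is_model C S P I} \<subseteq> ?U"
    by blast
  moreover have "\<phi>' \<in> \<Inter>{I. is_model C S P I}"
    if "\<phi> \<in> \<Inter>{I. is_model C S P I}" "wf_qcatom C \<phi>'" "observable C \<phi>'" "qc_entails C \<phi> \<phi>'" for \<phi> \<phi>'
    using that unfolding is_model_def qc_interpretation_def by blast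
  moreover have "\<phi> \<in> \<Inter>{I. is_model C S P I}"
    if "cl \<in> P" "wf_qcatom C \<phi>" "is_defined \<phi>" "observable C \<phi>"
      "immediate_consequence C S (\<Inter>{I. is_model C S P I}) cl \<phi>" for cl \<phi>
  proof (rule InterI)
    fix J assume "J \<in> {I. is_model C S P I}"
    then have J: "is_model C S P J" by simp
    have "immediate_consequence C S J cl \<phi>"
      using that(5) by (rule immediate_consequence_mono) (use J in blast)
    then show "\<phi> \<in> J"
      using J that unfolding is_model_def by blast
  qed
  ultimately show ?thesis
    unfolding is_model_def[of C S P "\<Inter>{I. is_model C S P I}"] qc_interpretation_def by blast
qed

lemma least_model_eq_Inter: "least_model C S P = \<Inter>{I. is_model C S P I}"
  unfolding least_model_def by (rule Least_equality) (auto intro: is_model_Inter)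

lemma is_model_least_model: "is_model C S P (least_model C S P)"
  unfolding least_model_eq_Inter by (rule is_model_Inter)

lemma least_model_least: "is_model C S P I \<Longrightarrow> least_model C S P \<subseteq> I"
  unfolding least_model_eq_Inter by blast

end

theory Submission
  imports Defs
begin

text \<open>
  Derivability is stable under entailment, because substitutions can be pushed through derivation
  trees and do not decrease proximity; hence the derivable observable defined qc-atoms form a model.
  Conversely, by induction on derivations every model satisfies the observable derivable qc-atoms:
  an observable conclusion forces observable premises, since a bottom qualification in a premise
  would make the qualification of the conclusion bottom.
\<close>

subsection \<open>Substitution\<close>

text \<open>Here \<theta> acts first. As valuations are themselves substitutions, the same operation
  pulls a valuation \<eta> back along \<theta>.\<close>

definition subst_comp :: "('v, 'b, 'c) subst \<Rightarrow> ('v, 'b, 'c) subst \<Rightarrow> ('v, 'b, 'c) subst" where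
  "subst_comp \<sigma> \<theta> = (\<lambda>x. tsubst \<sigma> (\<theta> x))"

lemma tsubst_subst_comp: "tsubst (subst_comp \<sigma> \<theta>) t = tsubst \<sigma> (tsubst \<theta> t)"
  by (induction t) (auto simp: subst_comp_def)

lemma map_tsubst_subst_comp:
  "map (tsubst (subst_comp \<sigma> \<theta>)) ts = map (tsubst \<sigma>) (map (tsubst \<theta>) ts)"
  by (simp add: tsubst_subst_comp)

lemma asubst_subst_comp: "asubst (subst_comp \<sigma> \<theta>) A = asubst \<sigma> (asubst \<theta> A)"
  by (cases A) (simp_all add: tsubst_subst_comp)

lemma tsubst_cong: "(\<And>x. x \<in> tvars t \<Longrightarrow> \<sigma> x = \<theta> x) \<Longrightarrow> tsubst \<sigma> t = tsubst \<theta> t"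
  by (induction t) auto

lemma finite_tvars: "finite (tvars t)"
  by (induction t) auto

lemma tvars_tsubst: "tvars (tsubst \<theta> t) = (\<Union>x\<in>tvars t. tvars (\<theta> x))"
  by (induction t) auto

lemma wf_trm_tsubst: "wf_subst C \<theta> \<Longrightarrow> wf_trm C t \<Longrightarrow> wf_trm C (tsubst \<theta> t)"
  by (induction t) (auto simp: wf_subst_def)

lemma wf_subst_comp: "wf_subst C \<sigma> \<Longrightarrow> wf_subst C \<theta> \<Longrightarrow> wf_subst C (subst_comp \<sigma> \<theta>)"
  using wf_trm_tsubst[of C \<sigma>] by (auto simp: wf_subst_def subst_comp_def)

lemma wf_atm_asubst: "wf_subst C \<theta> \<Longrightarrow> wf_atm C A \<Longrightarrow> wf_atm C (asubst \<theta> A)"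
  by (cases A) (auto intro: wf_trm_tsubst)

lemma valuations_subst_comp:
  assumes "\<eta> \<in> valuations C" "wf_subst C \<theta>"
  shows "subst_comp \<eta> \<theta> \<in> valuations C"
proof -
  have "wf_subst C \<eta>" and "\<And>x. tvars (\<eta> x) = {}"
    using assms(1) by (auto simp: valuations_def carrier_def wf_subst_def)
  then show ?thesis
    using assms(2) wf_subst_comp[of C \<eta> \<theta>]
    by (auto simp: valuations_def carrier_def wf_subst_def tvars_tsubst subst_comp_def)
qed

subsection \<open>Constraints\<close>

lemma finite_fv: "finite (fv \<pi>)"
  by (induction \<pi>) (auto simp: finite_tvars)

lemma solves_cong: "(\<And>x. x \<in> fv \<pi> \<Longrightarrow> \<eta> x = \<eta>' x) \<Longrightarrow> solves C \<pi> \<eta> = solves C \<pi> \<eta>'"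
proof (induction \<pi> arbitrary: \<eta> \<eta>')
  case (CPrim k ts)
  then have "map (tsubst \<eta>) ts = map (tsubst \<eta>') ts"
    by (auto intro!: tsubst_cong)
  then show ?case by (simp only: solves.simps)
next
  case (CEq t s)
  then show ?case using tsubst_cong[of t \<eta> \<eta>'] tsubst_cong[of s \<eta> \<eta>'] by simp
next
  case (CAnd \<pi> \<pi>')
  then show ?case by (metis UnCI fv.simps(3) solves.simps(3))
next
  case (CEx x \<pi>)
  have "solves C \<pi> (\<eta>(x := t)) = solves C \<pi> (\<eta>'(x := t))" for t
    using CEx.prems by (intro CEx.IH) auto
  then show ?case by simp
qed

text \<open>The semantic substitution lemma: since bound variables are renamed before they can be
  captured, instantiating by \<theta> amounts to pulling the valuation back along \<theta>. Both
  \<theta> and \<eta> vary in the induction, because a quantifier updates both.\<close>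

lemma solves_csubst: "solves C (csubst \<theta> \<pi>) \<eta> = solves C \<pi> (subst_comp \<eta> \<theta>)"
proof (induction \<pi> arbitrary: \<theta> \<eta>)
  case (CEx x \<pi>)
  define V where "V = (\<Union>z \<in> fv \<pi> - {x}. tvars (\<theta> z))"
  define y where "y = (if x \<in> V then SOME y. y \<notin> V else x)"
  have "finite V"
    by (simp add: V_def finite_fv finite_tvars)
  \<comment> \<open>The choice is genuinely fresh: \<open>V\<close> is finite while the type of
    variables is infinite.\<close>
  then have "(SOME y. y \<notin> V) \<notin> V"
    by (rule someI_ex[OF ex_new_if_finite[OF infinite_UNIV]])
  then have "y \<notin> V"
    by (simp add: y_def)
  \<comment> \<open>The two valuations need agree only on the free variables of \<pi>. For such a
    \<open>z\<close> other than \<open>x\<close>, updating \<eta> at \<open>y\<close> leaves the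
    value of \<open>\<theta> z\<close> unchanged because \<open>y\<close> lies outside
    \<open>V\<close>.\<close>
  have "solves C \<pi> (subst_comp (\<eta>(y := t)) (\<theta>(x := Var y)))
      = solves C \<pi> ((subst_comp \<eta> \<theta>)(x := t))" for t
  proof (rule solves_cong)
    fix z assume "z \<in> fv \<pi>"
    show "subst_comp (\<eta>(y := t)) (\<theta>(x := Var y)) z = ((subst_comp \<eta> \<theta>)(x := t)) z"
    proof (cases "z = x")
      case False
      with \<open>z \<in> fv \<pi>\<close> \<open>y \<notin> V\<close> have "y \<notin> tvars (\<theta> z)"
        by (auto simp: V_def)
      then have "tsubst (\<eta>(y := t)) (\<theta> z) = tsubst \<eta> (\<theta> z)"
        by (intro tsubst_cong) auto
      with False show ?thesis by (simp add: subst_comp_def)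
    qed (simp add: subst_comp_def)
  qed
  moreover have "csubst \<theta> (CEx x \<pi>) = CEx y (csubst (\<theta>(x := Var y)) \<pi>)"
    by (simp add: V_def y_def Let_def)
  ultimately show ?case by (simp only: solves.simps CEx.IH)
qed (simp_all add: tsubst_subst_comp map_tsubst_subst_comp comp_def)

lemma Sol_subst_comp:
  assumes "wf_subst C \<theta>" "\<forall>\<pi>\<in>\<Pi>. centails C \<Pi>' (csubst \<theta> \<pi>)" "\<eta> \<in> Sol C \<Pi>'"
  shows "subst_comp \<eta> \<theta> \<in> Sol C \<Pi>"
  using assms valuations_subst_comp[of \<eta> C \<theta>]
  by (auto simp: Sol_def centails_def solves_csubst)

text \<open>A solution of \<open>\<Pi>'\<close> pulls back along \<theta> to a solution of \<Pi>,
  hence of \<pi>; by the substitution lemma the original valuation solves the instance of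
  \<pi>.\<close>

lemma centails_csubst:
  assumes "wf_subst C \<theta>" "\<forall>\<pi>\<in>\<Pi>. centails C \<Pi>' (csubst \<theta> \<pi>)" "centails C \<Pi> \<pi>"
  shows "centails C \<Pi>' (csubst \<theta> \<pi>)"
  unfolding centails_def
proof
  fix \<eta> assume \<eta>: "\<eta> \<in> Sol C \<Pi>'"
  with assms have "subst_comp \<eta> \<theta> \<in> Sol C {\<pi>}"
    using Sol_subst_comp unfolding centails_def by blast
  with \<eta> show "\<eta> \<in> Sol C {csubst \<theta> \<pi>}"
    by (simp add: Sol_def solves_csubst)
qed

subsection \<open>Proximity\<close>

lemma glb_Cons: "glb (d # ds) = inf d (glb ds)"
  by (simp add: glb_def)

lemma glb_eq_bot: "bot \<in> set ds \<Longrightarrow> glb ds = bot"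
  by (induction ds) (auto simp: glb_def)

lemma glb_mono: "list_all2 (\<le>) ds es \<Longrightarrow> glb ds \<le> glb es"
  by (induction rule: list_all2_induct) (simp_all only: glb_Cons inf_mono order_refl)

text \<open>A variable is close only to itself, and then both instances coincide and reflexivity
  yields \<open>top\<close>. Constructor terms follow argumentwise by monotonicity of
  \<open>glb\<close>. The inequality can be strict, as instantiation may identify a variable with
  another term.\<close>

lemma prox_tsubst:
  assumes "\<And>x. S x x = top"
  shows "prox S t s \<le> prox S (tsubst \<theta> t) (tsubst \<theta> s)"
  using assms
proof (induction S t s rule: prox.induct)
  case (4 S c ts c' ts')
  show ?case
  proof (cases "length ts = length ts'")
    case True
    have "glb (map (\<lambda>(t, t'). prox S t t') (zip ts ts'))
        \<le> glb (map (\<lambda>(t, t'). prox S t t') (zip (map (tsubst \<theta>) ts) (map (tsubst \<theta>) ts')))"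
      by (rule glb_mono) (auto simp: list_all2_conv_all_nth True set_zip intro!: 4)
    then show ?thesis
      using True by (simp add: le_infI2)
  qed simp
qed (simp_all add: prox_refl)

text \<open>The \<theta>-instances of the old witnesses serve as new witnesses.\<close>

lemma near_tsubst:
  assumes "\<And>x. S x x = top" "wf_subst C \<theta>" "\<forall>\<pi>\<in>\<Pi>. centails C \<Pi>' (csubst \<theta> \<pi>)"
    and "near C S d \<Pi> t s"
  shows "near C S d \<Pi>' (tsubst \<theta> t) (tsubst \<theta> s)"
proof -
  obtain t' s' where "d \<noteq> bot" "wf_trm C t'" "wf_trm C s'" "centails C \<Pi> (CEq t t')"
    "centails C \<Pi> (CEq s s')" and d: "d \<le> prox S t' s'"
    using assms(4) by (auto simp: near_def)
  moreover have "d \<le> prox S (tsubst \<theta> t') (tsubst \<theta> s')"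
    using d prox_tsubst[OF assms(1)] by (rule order_trans)
  ultimately show ?thesis
    using centails_csubst[OF assms(2,3)] wf_trm_tsubst[OF assms(2)]
    unfolding near_def by (metis csubst.simps(2))
qed

subsection \<open>Derivability\<close>

text \<open>Only \<open>SQEA\<close> concludes an equational qc-atom, so rule inversion recovers its
  side conditions.\<close>

lemma derivable_Eqn_iff:
  "derivable C S P (QC (Eqn t s) d \<Pi>) \<longleftrightarrow> wf_qcatom C (QC (Eqn t s) d \<Pi>) \<and> near C S d \<Pi> t s"
  by (rule iffI, erule derivable.cases) (auto intro: SQEA)

lemma derivable_Prim_iff:
  "derivable C S P (QC (Prim k ts) d \<Pi>) \<longleftrightarrow>
    wf_qcatom C (QC (Prim k ts) d \<Pi>) \<and> centails C \<Pi> (CPrim k ts)"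
  by (rule iffI, erule derivable.cases) (auto intro: SQPA)

text \<open>The last rule must be \<open>SQDA\<close>, which constrains the qualification of its
  conclusion only by an upper bound.\<close>

lemma derivable_Defined_antimono:
  assumes "derivable C S P (QC (Defined p ts) d \<Pi>)" "d' \<le> d"
  shows "derivable C S P (QC (Defined p ts) d' \<Pi>)"
  using assms(1)
proof cases
  case (SQDA q us \<alpha> Bs \<theta> ds es d0)
  show ?thesis
    by (rule derivable.SQDA[OF _ SQDA(2-11)]) (use SQDA assms(2) in auto)
qed

text \<open>An \<open>SQDA\<close> step using the clause instance \<sigma> becomes one using
  \<sigma> followed by \<theta>, with all qualifications kept. The leaves survive because
  \<open>near\<close> and constraint entailment are stable under \<theta>.\<close>

lemma derivable_asubst:
  fixes C :: "('v::infinite, 'b, 'c, 'p, 'k) constraint_domain"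
  assumes refl: "\<And>x. S x x = top"
    and "derivable C S P (QC A d \<Pi>)"
    and "wf_subst C \<theta>" "\<forall>\<pi>\<in>\<Pi>. centails C \<Pi>' (csubst \<theta> \<pi>)" "\<forall>\<pi>\<in>\<Pi>'. wf_constr C \<pi>"
  shows "derivable C S P (QC (asubst \<theta> A) d \<Pi>')"
  using assms(2)
\<comment> \<open>All nodes of a derivation carry the same constraint set, so \<Pi> stays fixed
  while the atom and its qualification vary.\<close>
proof (induction "QC A d \<Pi>" arbitrary: A d rule: derivable.induct)
  case (SQDA p' ts' d p ts \<alpha> Bs \<sigma> ds es d0)
  have "derivable C S P (QC (Defined p' (map (tsubst \<theta>) ts')) d \<Pi>')"
  proof (rule derivable.SQDA)
    show "Clause p ts \<alpha> Bs \<in> P"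
      by (rule SQDA.hyps)
    show "S (SDef p') (SDef p) = d0" "d \<le> inf (inf d0 (glb ds)) (\<alpha> \<odot> glb es)"
      by (rule SQDA.hyps)+
    show "wf_qcatom C (QC (Defined p' (map (tsubst \<theta>) ts')) d \<Pi>')"
      using SQDA.hyps(1) wf_atm_asubst[of C \<theta> "Defined p' ts'"] assms(3,5) by simp
    show "wf_subst C (subst_comp \<theta> \<sigma>)"
      using assms(3) SQDA.hyps by (intro wf_subst_comp)
    \<comment> \<open>The facts \<open>SQDA.hyps(10)\<close> and \<open>SQDA.hyps(12)\<close> are
      the induction hypotheses for the equational premises and the body atoms.\<close>
    show "derivable C S P
        (QC (Eqn (map (tsubst \<theta>) ts' ! i) (tsubst (subst_comp \<theta> \<sigma>) (ts ! i))) (ds ! i) \<Pi>')"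
      if "i < length ts" for i
      using SQDA.hyps(10)[OF that] SQDA.hyps(4) that by (simp add: tsubst_subst_comp)
    show "derivable C S P (QC (asubst (subst_comp \<theta> \<sigma>) (fst (Bs ! j))) (es ! j) \<Pi>')"
      if "j < length Bs" for j
      using SQDA.hyps(12)[OF that] by (simp add: asubst_subst_comp)
  qed (simp_all add: SQDA.hyps)
  then show ?case by simp
next
  case (SQEA t s d)
  then show ?case
    using near_tsubst[where S = S, OF refl assms(3,4)] assms(3,5)
    by (simp add: derivable_Eqn_iff wf_trm_tsubst)
next
  case (SQPA k ts d)
  then have "centails C \<Pi>' (csubst \<theta> (CPrim k ts))"
    using assms(3,4) by (intro centails_csubst)
  with SQPA show ?case
    using assms(3,5) by (auto simp: derivable_Prim_iff intro: wf_trm_tsubst)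
qed

subsection \<open>The least model\<close>

definition derivable_atoms ::
  "('v, 'b, 'c, 'p, 'k) constraint_domain \<Rightarrow> ('v, 'b, 'c, 'p, 'k, 'd::qualification_domain) proximity \<Rightarrow>
   ('v, 'b, 'c, 'p, 'k, 'd) clause set \<Rightarrow> ('v, 'b, 'c, 'p, 'k, 'd) qcatom set" where
  "derivable_atoms C S P =
    {\<phi>. wf_qcatom C \<phi> \<and> observable C \<phi> \<and> is_defined \<phi> \<and> derivable C S P \<phi>}"

text \<open>Entailment is handled in two moves: instantiate and change the constraint set at the
  same qualification, then lower the qualification.\<close>

lemma qc_interpretation_derivable_atoms:
  fixes C :: "('v::infinite, 'b, 'c, 'p, 'k) constraint_domain"
  assumes refl: "\<And>x. S x x = top"
  shows "qc_interpretation C (derivable_atoms C S P)"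
  unfolding qc_interpretation_def
proof (intro conjI ballI allI impI)
  fix \<phi> \<phi>' assume \<phi>: "\<phi> \<in> derivable_atoms C S P"
    and \<phi>': "wf_qcatom C \<phi>' \<and> observable C \<phi>' \<and> qc_entails C \<phi> \<phi>'"
  obtain p ts d \<Pi> where [simp]: "\<phi> = QC (Defined p ts) d \<Pi>"
    using \<phi> by (cases \<phi>) (auto simp: derivable_atoms_def)
  obtain A' d' \<Pi>' where [simp]: "\<phi>' = QC A' d' \<Pi>'"
    by (cases \<phi>')
  obtain \<theta> where \<theta>: "wf_subst C \<theta>" "\<forall>\<pi>\<in>\<Pi>. centails C \<Pi>' (csubst \<theta> \<pi>)"
    and A': "A' = asubst \<theta> (Defined p ts)" and "d' \<le> d"
    using \<phi>' by auto
  have "derivable C S P (QC A' d \<Pi>')"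
    unfolding A' using \<phi> \<phi>' \<theta> by (intro derivable_asubst[OF refl]) (auto simp: derivable_atoms_def)
  then have "derivable C S P \<phi>'"
    using \<open>d' \<le> d\<close> A' derivable_Defined_antimono by auto
  then show "\<phi>' \<in> derivable_atoms C S P"
    using \<phi>' A' by (auto simp: derivable_atoms_def)
qed (auto simp: derivable_atoms_def)

text \<open>For equational and primitive atoms \<open>holds\<close> does not include
  well-formedness, which \<open>SQEA\<close> and \<open>SQPA\<close> demand; the second assumption
  supplies it.\<close>

lemma holds_derivable_atoms_imp_derivable:
  assumes "holds C S (derivable_atoms C S P) \<phi>" "wf_qcatom C \<phi>"
  shows "derivable C S P \<phi>"
  using assms
  by (cases "(C, S, derivable_atoms C S P, \<phi>)" rule: holds.cases)
    (auto simp: derivable_atoms_def derivable_Eqn_iff derivable_Prim_iff)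

text \<open>An immediate consequence provides the data of an \<open>SQDA\<close> step.
  Well-formedness of the clauses makes the instantiated premises well formed, so that they become
  derivable.\<close>

lemma is_model_derivable_atoms:
  fixes C :: "('v::infinite, 'b, 'c, 'p, 'k) constraint_domain"
  assumes "\<And>x. S x x = top" "is_program C P"
  shows "is_model C S P (derivable_atoms C S P)"
  unfolding is_model_def
proof (intro conjI ballI allI impI)
  show "qc_interpretation C (derivable_atoms C S P)"
    using assms(1) by (rule qc_interpretation_derivable_atoms)
next
  fix cl \<phi>
  assume "cl \<in> P" and \<phi>: "wf_qcatom C \<phi> \<and> is_defined \<phi> \<and> observable C \<phi> \<and>
    immediate_consequence C S (derivable_atoms C S P) cl \<phi>"
  obtain p ts \<alpha> Bs where cl: "cl = Clause p ts \<alpha> Bs" by (cases cl)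
  obtain A d \<Pi> where QC: "\<phi> = QC A d \<Pi>" by (cases \<phi>)
  obtain p' ts' \<theta> ds es where
    A: "A = Defined p' ts'" and \<theta>: "wf_subst C \<theta>" and
    len: "length ts' = length ts" "length ds = length ts" "length es = length Bs" and
    d0: "S (SDef p') (SDef p) \<noteq> bot" and
    near: "\<And>i. i < length ts \<Longrightarrow> near C S (ds ! i) \<Pi> (ts' ! i) (tsubst \<theta> (ts ! i))" and
    body: "\<And>j. j < length Bs \<Longrightarrow>
      holds C S (derivable_atoms C S P) (QC (asubst \<theta> (fst (Bs ! j))) (es ! j) \<Pi>)" and
    thr: "\<And>j. j < length Bs \<Longrightarrow> meets_threshold (es ! j) (snd (Bs ! j))" and
    d: "d \<le> inf (inf (S (SDef p') (SDef p)) (glb ds)) (\<alpha> \<odot> glb es)"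
    using \<phi> unfolding cl QC immediate_consequence.simps by blast
  have wf_cl: "wf_clause C (Clause p ts \<alpha> Bs)"
    using assms(2) \<open>cl \<in> P\<close> unfolding cl is_program_def by blast
  have wf: "wf_qcatom C (QC (Defined p' ts') d \<Pi>)"
    using \<phi> QC A by simp
  have "derivable C S P (QC (Defined p' ts') d \<Pi>)"
  proof (rule SQDA[OF wf _ \<theta> len])
    show "S (SDef p') (SDef p) = S (SDef p') (SDef p)" ..
    show "S (SDef p') (SDef p) \<noteq> bot" by (rule d0)
    show "d \<le> inf (inf (S (SDef p') (SDef p)) (glb ds)) (\<alpha> \<odot> glb es)" by (rule d)
    show "meets_threshold (es ! j) (snd (Bs ! j))" if "j < length Bs" for j
      using that by (rule thr)
    show "Clause p ts \<alpha> Bs \<in> P" using \<open>cl \<in> P\<close> cl by simp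
    show "derivable C S P (QC (Eqn (ts' ! i) (tsubst \<theta> (ts ! i))) (ds ! i) \<Pi>)"
      if "i < length ts" for i
      using that near wf wf_cl \<theta> len by (auto simp: derivable_Eqn_iff intro: wf_trm_tsubst)
    show "derivable C S P (QC (asubst \<theta> (fst (Bs ! j))) (es ! j) \<Pi>)" if "j < length Bs" for j
    proof (rule holds_derivable_atoms_imp_derivable[OF body[OF that]])
      have "wf_atm C (fst (Bs ! j))"
        using wf_cl nth_mem[OF that] by (auto split: prod.splits)
      then show "wf_qcatom C (QC (asubst \<theta> (fst (Bs ! j))) (es ! j) \<Pi>)"
        using wf \<theta> by (auto intro: wf_atm_asubst)
    qed
  qed
  then show "\<phi> \<in> derivable_atoms C S P"
    using \<phi> QC A by (auto simp: derivable_atoms_def)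
qed

text \<open>Speaking of \<open>holds\<close> instead of membership lets the induction cover
  equational and primitive body atoms as well.\<close>

lemma derivable_imp_holds:
  assumes "is_model C S P I" "derivable C S P \<phi>" "observable C \<phi>"
  shows "holds C S I \<phi>"
  using assms(2,3)
proof (induction rule: derivable.induct)
  case (SQDA p' ts' d \<Pi> p ts \<alpha> Bs \<theta> ds es d0)
  \<comment> \<open>A bottom entry would make \<open>glb es\<close> bottom, hence also
    \<open>\<alpha> \<odot> glb es\<close> and its lower bound \<open>d\<close>, against
    observability.\<close>
  have "bot \<notin> set es"
    using SQDA.prems SQDA.hyps by (auto dest: glb_eq_bot simp: attenuate_bot bot_unique)
  have near: "near C S (ds ! i) \<Pi> (ts' ! i) (tsubst \<theta> (ts ! i))" if "i < length ts" for i
    using SQDA(9)[OF that] by (simp add: derivable_Eqn_iff)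
  \<comment> \<open>The relation \<open>near\<close> itself demands a nonbottom
    qualification.\<close>
  then have "bot \<notin> set ds"
    using \<open>length ds = length ts\<close> by (auto simp: in_set_conv_nth near_def)
  have "holds C S I (QC (asubst \<theta> (fst (Bs ! j))) (es ! j) \<Pi>)" if "j < length Bs" for j
  proof (rule SQDA.IH(2)[OF that])
    have "es ! j \<noteq> bot"
      using \<open>bot \<notin> set es\<close> that \<open>length es = length Bs\<close> nth_mem by metis
    \<comment> \<open>Satisfiability is inherited, as premise and conclusion share \<Pi>.\<close>
    then show "observable C (QC (asubst \<theta> (fst (Bs ! j))) (es ! j) \<Pi>)"
      using SQDA.prems by simp
  qed
  with near \<open>bot \<notin> set es\<close> \<open>bot \<notin> set ds\<close> SQDA.hyps
  have "immediate_consequence C S I (Clause p ts \<alpha> Bs) (QC (Defined p' ts') d \<Pi>)"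
    unfolding immediate_consequence.simps by blast
  then have "QC (Defined p' ts') d \<Pi> \<in> I"
    using assms(1) SQDA.hyps(1,2) SQDA.prems unfolding is_model_def
    by (metis is_defined.simps)
  then show ?case by simp
qed simp_all

theorem theorem2:
  fixes C :: "('v::infinite, 'b, 'c, 'p, 'k) constraint_domain"
    and S :: "('v, 'b, 'c, 'p, 'k, 'd::qualification_domain) proximity"
    and P :: "('v, 'b, 'c, 'p, 'k, 'd) clause set"
  assumes "admissible_triple C S"
    and "is_program C P"
  shows "least_model C S P =
    {\<phi>. wf_qcatom C \<phi> \<and> observable C \<phi> \<and> is_defined \<phi> \<and> derivable C S P \<phi>}"
  unfolding derivable_atoms_def[symmetric]
proof
  have "S x x = top" for x
    using assms(1) by (simp add: admissible_triple_def admissible_proximity_def)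
  then show "least_model C S P \<subseteq> derivable_atoms C S P"
    using assms(2) by (intro least_model_least is_model_derivable_atoms)
  show "derivable_atoms C S P \<subseteq> least_model C S P"
  proof
    fix \<phi> assume \<phi>: "\<phi> \<in> derivable_atoms C S P"
    then have "holds C S (least_model C S P) \<phi>"
      using derivable_imp_holds[OF is_model_least_model] by (auto simp: derivable_atoms_def)
    \<comment> \<open>For a defined qc-atom, \<open>holds\<close> is membership.\<close>
    with \<phi> show "\<phi> \<in> least_model C S P"
      by (cases \<phi>) (auto simp: derivable_atoms_def)
  qed
qed

end
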